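(* For every $\alpha\in(0,1)$ there exists a bounded function $u:[0,+\infty)\to\mathbb{R}$, whose Caputo derivative $\partial_t^\alpha u(t)$ of order $\alpha$ exists for every $t>0$, such that $$\partial_t^\alpha u(t)\ge0\quad\text{for all }t>0\qquad\text{and}\qquad \liminf_{t\to+\infty}u(t)<\limsup_{t\to+\infty}u(t).$$ In particular $u(t)$ has no limit as $t\to+\infty$.
   Context: Caputo derivative of order $\alpha\in(0,1)$: for $\phi\in C^1(0,+\infty)$ it is $\partial_t^\alpha\phi(t)=\frac{1}{\Gamma(1-\alpha)}\int_0^t\frac{\phi'(s)}{|t-s|^\alpha}ds$; equivalently, for suitable $\phi$ and up to a positive multiplicative constant depending only on $\alpha$, it is $\int_{-\infty}^t\frac{\phi(t)-\phi(s)}{|t-s|^{1+\alpha}}ds$, where $\phi$ is extended by $\phi(s)=\phi(0)$ for $s<0$. *)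

theory Defs
  imports "HOL-Analysis.Analysis"
begin

definition caputo_integrand :: "real \<Rightarrow> (real \<Rightarrow> real) \<Rightarrow> real \<Rightarrow> real \<Rightarrow> real" where
  "caputo_integrand \<alpha> \<phi> t s = deriv \<phi> s / \<bar>t - s\<bar> powr \<alpha>"

text \<open>The derivative is taken on the open half-line only, and the integral is a Lebesgue integral
  over \<open>(0,t)\<close>, so that existence at \<open>t\<close> means absolute convergence.\<close>

definition caputo_deriv_exists :: "real \<Rightarrow> (real \<Rightarrow> real) \<Rightarrow> real \<Rightarrow> bool" where
  "caputo_deriv_exists \<alpha> \<phi> t \<longleftrightarrow>
     \<phi> C1_differentiable_on {0<..} \<and>
     set_integrable lborel {0<..<t} (caputo_integrand \<alpha> \<phi> t)"

definition caputo_deriv :: "real \<Rightarrow> (real \<Rightarrow> real) \<Rightarrow> real \<Rightarrow> real" where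
  "caputo_deriv \<alpha> \<phi> t =
     1 / Gamma (1 - \<alpha>) * (LINT s:{0<..<t}|lborel. caputo_integrand \<alpha> \<phi> t s)"

end

theory Submission
  imports Defs
begin

text \<open>Take \<open>u(t) = A t/(1+t) + sin(ln(1+t))\<close> with \<open>A\<close> large. The slow oscillation
  \<open>sin(ln(1+t))\<close> persists at infinity, but its Caputo derivative is only of size \<open>t\<^sup>-\<^sup>\<alpha>\<close>: on
  \<open>[0,t/2]\<close> the kernel \<open>(t-s)\<^sup>-\<^sup>\<alpha>\<close> is monotone and comparable to \<open>t\<^sup>-\<^sup>\<alpha>\<close>, so the second mean value
  theorem bounds the integral by the oscillation of the function, and on \<open>[t/2,t]\<close> its derivative
  is at most \<open>2/t\<close>. The increasing part \<open>A t/(1+t)\<close> contributes at least \<open>A/2\<close> times \<open>t\<^sup>-\<^sup>\<alpha>\<close> for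
  \<open>t \<ge> 2\<close>, which absorbs this, while for \<open>t \<le> 2\<close> the whole function is increasing.\<close>

section \<open>Integrability of the singular kernel\<close>

lemma has_integral_powr_kernel:
  fixes \<alpha> a t :: real
  assumes "\<alpha> < 1" and "a \<le> t"
  shows "((\<lambda>s. (t - s) powr (-\<alpha>)) has_integral (t - a) powr (1 - \<alpha>) / (1 - \<alpha>)) {a..t}"
proof -
  let ?F = "\<lambda>s. - ((t - s) powr (1 - \<alpha>) / (1 - \<alpha>))"
  have "((\<lambda>s. (t - s) powr (-\<alpha>)) has_integral (?F t - ?F a)) {a..t}"
  \<comment> \<open>As \<alpha> < 1, the antiderivative is continuous up to \<open>s = t\<close>,
    but for positive \<alpha> it is not differentiable there; hence the interior version of the
    theorem.\<close>
  proof (rule fundamental_theorem_of_calculus_interior)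
    show "continuous_on {a..t} ?F"
      using assms by (intro continuous_on_minus continuous_on_divide continuous_on_powr'
          continuous_on_diff continuous_on_const continuous_on_id) auto
    show "(?F has_vector_derivative (t - s) powr (-\<alpha>)) (at s)" if "s \<in> {a<..<t}" for s
      unfolding has_real_derivative_iff_has_vector_derivative [symmetric]
      using assms that by (auto intro!: derivative_eq_intros)
  qed (use assms in auto)
  then show ?thesis
    by simp
qed

lemma continuous_times_powr_kernel_absolutely_integrable:
  fixes \<alpha> a t :: real
  assumes "\<alpha> < 1" and "a \<le> t" and w: "continuous_on {a..t} w"
  shows "(\<lambda>s. w s * (t - s) powr (-\<alpha>)) absolutely_integrable_on {a..t}"
proof (rule absolutely_integrable_bounded_measurable_product_real)
  show "w \<in> borel_measurable (lebesgue_on {a..t})"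
    using w by (intro continuous_imp_measurable_on_sets_lebesgue) auto
  show "bounded (w ` {a..t})"
    by (intro compact_imp_bounded compact_continuous_image w compact_Icc)
  show "(\<lambda>s. (t - s) powr (-\<alpha>)) absolutely_integrable_on {a..t}"
    using has_integral_powr_kernel [OF assms(1,2)]
    by (intro nonnegative_absolutely_integrable_1) auto
qed auto

text \<open>Absolute integrability refers to \<open>lebesgue\<close>, the completion of
  \<open>lborel\<close>. Descending to \<open>lborel\<close> takes Borel measurability, which
  follows from continuity on the open interval, away from the singularity at
  \<open>t\<close>.\<close>

lemma continuous_times_powr_kernel_set_integrable:
  fixes \<alpha> t :: real
  assumes "\<alpha> < 1" and "0 \<le> t" and w: "continuous_on {0..t} w"
  shows "set_integrable lborel {0<..<t} (\<lambda>s. w s * (t - s) powr (-\<alpha>))"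
proof -
  have "(\<lambda>s. w s * (t - s) powr (-\<alpha>)) absolutely_integrable_on {0<..<t}"
    by (rule set_integrable_subset [OF continuous_times_powr_kernel_absolutely_integrable[OF assms]]) auto
  moreover have "continuous_on {0<..<t} (\<lambda>s. w s * (t - s) powr (-\<alpha>))"
    by (intro continuous_intros continuous_on_subset [OF w]) auto
  then have "(\<lambda>s. indicator {0<..<t} s *\<^sub>R (w s * (t - s) powr (-\<alpha>))) \<in> borel_measurable borel"
    by (intro borel_measurable_continuous_on_indicator) auto
  ultimately show ?thesis
    unfolding set_integrable_def by (subst (asm) integrable_completion) auto
qed

section \<open>The Caputo derivative as a gauge integral\<close>

lemma caputo_integrand_C1:
  assumes "(u has_real_derivative w s) (at s)" and "s < t"
  shows "caputo_integrand \<alpha> u t s = w s * (t - s) powr (-\<alpha>)"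
  using assms by (simp add: caputo_integrand_def DERIV_imp_deriv powr_minus divide_inverse)

text \<open>The endpoints form a null set, so the Lebesgue integral of the definition becomes a
  gauge integral over a closed interval, the setting of the mean value theorem and of interval
  splitting below.\<close>

lemma
  fixes \<alpha> t :: real
  assumes "\<alpha> < 1" and "0 \<le> t"
    and w: "continuous_on {0..t} w"
    and u: "\<And>s. s \<in> {0<..<t} \<Longrightarrow> (u has_real_derivative w s) (at s)"
  shows caputo_integrand_set_integrable:
      "set_integrable lborel {0<..<t} (caputo_integrand \<alpha> u t)"
    and caputo_deriv_eq_integral:
      "caputo_deriv \<alpha> u t = 1 / Gamma (1 - \<alpha>) * integral {0..t} (\<lambda>s. w s * (t - s) powr (-\<alpha>))"
proof -
  note int = continuous_times_powr_kernel_set_integrable [OF assms(1-3)]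
  have eq: "caputo_integrand \<alpha> u t s = w s * (t - s) powr (-\<alpha>)" if "s \<in> {0<..<t}" for s
    using that by (intro caputo_integrand_C1 u) auto
  have "set_integrable lborel {0<..<t} (caputo_integrand \<alpha> u t)
      \<longleftrightarrow> set_integrable lborel {0<..<t} (\<lambda>s. w s * (t - s) powr (-\<alpha>))"
    by (intro set_integrable_cong refl eq)
  then show "set_integrable lborel {0<..<t} (caputo_integrand \<alpha> u t)"
    using int by simp
  have "(LINT s:{0<..<t}|lborel. caputo_integrand \<alpha> u t s)
      = (LINT s:{0<..<t}|lborel. w s * (t - s) powr (-\<alpha>))"
    by (rule set_lebesgue_integral_cong) (use eq in auto)
  also have "\<dots> = integral {0..t} (\<lambda>s. w s * (t - s) powr (-\<alpha>))"
    by (simp add: set_borel_integral_eq_integral(2) [OF int] integral_open_interval_real)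
  finally show "caputo_deriv \<alpha> u t = 1 / Gamma (1 - \<alpha>) * integral {0..t} (\<lambda>s. w s * (t - s) powr (-\<alpha>))"
    by (simp add: caputo_deriv_def)
qed

section \<open>The oscillating function and its derivative\<close>

definition log_osc :: "real \<Rightarrow> real \<Rightarrow> real" where
  "log_osc A t = A * (t / (1 + t)) + sin (ln (1 + t))"

definition log_osc' :: "real \<Rightarrow> real \<Rightarrow> real" where
  "log_osc' A t = A / (1 + t)\<^sup>2 + cos (ln (1 + t)) / (1 + t)"

lemma log_osc_has_derivative:
  assumes "t > -1"
  shows "(log_osc A has_real_derivative log_osc' A t) (at t)"
  unfolding log_osc_def log_osc'_def
  using assms by (auto intro!: derivative_eq_intros simp: field_simps power2_eq_square)

lemma continuous_on_log_osc': "continuous_on {0..} (log_osc' A)"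
  unfolding log_osc'_def by (intro continuous_intros) auto

lemma log_osc'_ge:
  assumes "A \<ge> 0" and "t \<ge> 0"
  shows "log_osc' A t \<ge> - (1 / (1 + t))"
proof -
  have "- (1 / (1 + t)) \<le> cos (ln (1 + t)) / (1 + t)"
    using assms divide_right_mono [OF cos_ge_minus_one, of "1 + t"] by simp
  moreover have "A / (1 + t)\<^sup>2 \<ge> 0"
    using assms by simp
  ultimately show ?thesis
    unfolding log_osc'_def by linarith
qed

text \<open>As long as \<open>1 + t\<close> stays below \<open>A\<close>, the rational term
  dominates the cosine term. This settles small times.\<close>

lemma log_osc'_nonneg:
  assumes "A \<ge> 1 + t" and "t \<ge> 0"
  shows "log_osc' A t \<ge> 0"
proof -
  have "A / (1 + t)\<^sup>2 \<ge> (1 + t) / (1 + t)\<^sup>2"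
    using assms by (intro divide_right_mono) auto
  moreover have "(1 + t) / (1 + t)\<^sup>2 = 1 / (1 + t)"
    by (simp add: power2_eq_square)
  moreover have "- (1 / (1 + t)) \<le> cos (ln (1 + t)) / (1 + t)"
    using assms divide_right_mono [OF cos_ge_minus_one, of "1 + t"] by simp
  ultimately show ?thesis
    unfolding log_osc'_def by linarith
qed

lemma integral_log_osc':
  assumes "0 \<le> a" and "a \<le> b"
  shows "integral {a..b} (log_osc' A) = log_osc A b - log_osc A a"
proof (rule integral_unique, rule fundamental_theorem_of_calculus)
  show "(log_osc A has_vector_derivative log_osc' A x) (at x within {a..b})" if "x \<in> {a..b}" for x
    unfolding has_real_derivative_iff_has_vector_derivative [symmetric]
    using log_osc_has_derivative [of x A] that assms by (auto intro: has_field_derivative_at_within)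
qed fact

section \<open>Lower bounds for the kernel integral\<close>

lemma integral_log_osc'_kernel_head_ge:
  fixes \<alpha> a t A :: real
  assumes "0 \<le> \<alpha>" and "A \<ge> 0" and "0 \<le> a" and "a < t"
  shows "integral {0..a} (\<lambda>s. log_osc' A s * (t - s) powr (-\<alpha>))
       \<ge> t powr (-\<alpha>) * (A * (a / (1 + a)) - 1) - 2 * (t - a) powr (-\<alpha>)"
proof -
  let ?k = "\<lambda>s. (t - s) powr (-\<alpha>)"
  let ?\<phi> = "\<lambda>s::real. s / (1 + s)"
  have mono: "?k x \<le> ?k y" if "x \<le> y" "y \<le> a" for x y
    using that assms by (intro powr_mono2') auto
  have "log_osc' A integrable_on {0..a}"
    by (intro integrable_continuous_real continuous_on_subset [OF continuous_on_log_osc']) auto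
  \<comment> \<open>The kernel increases on \<open>{0..a}\<close>, so it may be replaced by its end
    values \<open>?k 0\<close> before \<open>c\<close> and \<open>?k a\<close> after
    \<open>c\<close>.\<close>
  from second_mean_value_theorem [OF this \<open>0 \<le> a\<close>, of ?k] mono
  obtain c where c: "c \<in> {0..a}"
    and eq: "integral {0..a} (\<lambda>s. ?k s * log_osc' A s)
      = ?k 0 * integral {0..c} (log_osc' A) + ?k a * integral {c..a} (log_osc' A)"
    by blast
  have phi: "?\<phi> c \<le> ?\<phi> a"
    using c by (auto simp: field_simps)
  \<comment> \<open>The increasing part may be given the smaller weight \<open>?k 0\<close>
    throughout, so its increments telescope. The sine starts at 0 and loses at most 1 before
    \<open>c\<close> and at most 2 after it.\<close>
  have "?k 0 * (A * (?\<phi> a - ?\<phi> c)) \<le> ?k a * (A * (?\<phi> a - ?\<phi> c))"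
    using mono [of 0 a] assms phi by (intro mult_right_mono) auto
  moreover have "?k 0 * (-1) \<le> ?k 0 * sin (ln (1 + c))"
    by (intro mult_left_mono) auto
  moreover have "?k a * (-2) \<le> ?k a * (sin (ln (1 + a)) - sin (ln (1 + c)))"
    using sin_ge_minus_one [of "ln (1 + a)"] sin_le_one [of "ln (1 + c)"]
    by (intro mult_left_mono) (linarith | simp)+
  moreover have "integral {0..a} (\<lambda>s. log_osc' A s * ?k s)
      = ?k 0 * (A * ?\<phi> c + sin (ln (1 + c)))
        + ?k a * (A * (?\<phi> a - ?\<phi> c) + (sin (ln (1 + a)) - sin (ln (1 + c))))"
    using eq c by (simp add: integral_log_osc' log_osc_def algebra_simps)
  ultimately show ?thesis
    by (simp add: algebra_simps)
qed

text \<open>Up to the singularity the kernel is merely integrable, so here the derivative is bounded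
  pointwise by \<open>log_osc'_ge\<close> and the kernel is integrated exactly.\<close>

lemma integral_log_osc'_kernel_tail_ge:
  fixes \<alpha> a t A :: real
  assumes "\<alpha> < 1" and "A \<ge> 0" and "0 \<le> a" and "a \<le> t"
  shows "integral {a..t} (\<lambda>s. log_osc' A s * (t - s) powr (-\<alpha>))
       \<ge> - (1 / (1 + a)) * ((t - a) powr (1 - \<alpha>) / (1 - \<alpha>))"
proof (rule has_integral_le)
  show "((\<lambda>s. - (1 / (1 + a)) * (t - s) powr (-\<alpha>)) has_integral
      - (1 / (1 + a)) * ((t - a) powr (1 - \<alpha>) / (1 - \<alpha>))) {a..t}"
    using assms by (intro has_integral_mult_right has_integral_powr_kernel)
  have "continuous_on {a..t} (log_osc' A)"
    using assms by (intro continuous_on_subset [OF continuous_on_log_osc']) auto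
  then have "(\<lambda>s. log_osc' A s * (t - s) powr (-\<alpha>)) integrable_on {a..t}"
    using assms continuous_times_powr_kernel_absolutely_integrable set_lebesgue_integral_eq_integral(1)
    by blast
  then show "((\<lambda>s. log_osc' A s * (t - s) powr (-\<alpha>)) has_integral
      integral {a..t} (\<lambda>s. log_osc' A s * (t - s) powr (-\<alpha>))) {a..t}"
    by (rule integrable_integral)
  show "- (1 / (1 + a)) * (t - s) powr (-\<alpha>) \<le> log_osc' A s * (t - s) powr (-\<alpha>)"
    if "s \<in> {a..t}" for s
  proof (rule mult_right_mono)
    have "1 / (1 + s) \<le> 1 / (1 + a)"
      using that assms by (intro divide_left_mono) auto
    then show "- (1 / (1 + a)) \<le> log_osc' A s"
      using log_osc'_ge [of A s] that assms by auto
  qed auto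
qed

text \<open>In units of \<open>t powr (-\<alpha>)\<close>, for \<open>t > 2\<close> the head yields
  at least \<open>A / 2 - 5\<close> and the tail costs at most \<open>2 / (1 - \<alpha>)\<close>;
  the threshold on \<open>A\<close> balances the two.\<close>

lemma integral_log_osc'_kernel_nonneg:
  fixes \<alpha> t A :: real
  assumes "0 < \<alpha>" and "\<alpha> < 1" and "0 < t" and A: "A \<ge> 10 + 4 / (1 - \<alpha>)"
  shows "integral {0..t} (\<lambda>s. log_osc' A s * (t - s) powr (-\<alpha>)) \<ge> 0"
proof -
  have A10: "A \<ge> 10"
    using A assms by (smt (verit) divide_nonneg_pos)
  let ?g = "\<lambda>s. log_osc' A s * (t - s) powr (-\<alpha>)"
  have "?g absolutely_integrable_on {0..t}"
    using assms
    by (intro continuous_times_powr_kernel_absolutely_integrable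
        continuous_on_subset [OF continuous_on_log_osc']) auto
  then have int: "?g integrable_on {0..t}"
    by (rule set_lebesgue_integral_eq_integral(1))
  show ?thesis
  proof (cases "t \<le> 2")
    case True
    have "log_osc' A s * (t - s) powr (-\<alpha>) \<ge> 0" if "s \<in> {0..t}" for s
      using that True A10 by (intro mult_nonneg_nonneg log_osc'_nonneg) auto
    then show ?thesis
      by (intro integral_nonneg int)
  next
    case False
    define a where "a = t / 2"
    have a: "a > 1" "a < t" "t - a = a" "t = 2 * a"
      using False by (auto simp: a_def)
    let ?k0 = "t powr (-\<alpha>)" and ?ka = "a powr (-\<alpha>)"
    have ka: "?ka \<le> 2 * ?k0"
    proof -
      have "?ka = 2 powr \<alpha> * ?k0"
        using a by (simp add: powr_mult powr_minus field_simps)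
      also have "\<dots> \<le> 2 powr 1 * ?k0"
        using assms by (intro mult_right_mono powr_mono) auto
      finally show ?thesis
        by simp
    qed
    have tail: "integral {a..t} ?g \<ge> - (2 * ?k0 / (1 - \<alpha>))"
    proof -
      \<comment> \<open>The extra factor \<open>a\<close> is absorbed by the decay
        \<open>1 / (1 + a)\<close> of the derivative bound.\<close>
      have "a powr (1 - \<alpha>) = a * ?ka"
        using a powr_add [of a 1 "-\<alpha>"] by simp
      then have "1 / (1 + a) * (a powr (1 - \<alpha>) / (1 - \<alpha>)) = a / (1 + a) * (?ka / (1 - \<alpha>))"
        by simp
      also have "\<dots> \<le> 1 * (?ka / (1 - \<alpha>))"
        using a assms by (intro mult_right_mono) auto
      also have "\<dots> \<le> 2 * ?k0 / (1 - \<alpha>)"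
        using ka assms by (simp add: divide_right_mono)
      finally show ?thesis
        using integral_log_osc'_kernel_tail_ge [of \<alpha> A a t] a assms A10 by simp
    qed
    \<comment> \<open>The case split at \<open>t = 2\<close> gives \<open>a > 1\<close>, so the
      rational part has already made half of its total rise.\<close>
    have "A * (1 / 2) \<le> A * (a / (1 + a))"
      using a A10 by (intro mult_left_mono) (auto simp: field_simps)
    then have "?k0 * (A / 2 - 1) \<le> ?k0 * (A * (a / (1 + a)) - 1)"
      by (intro mult_left_mono) auto
    moreover have "integral {0..a} ?g \<ge> ?k0 * (A * (a / (1 + a)) - 1) - 2 * ?ka"
      using integral_log_osc'_kernel_head_ge [of \<alpha> A a t] a(1-3) assms A10 by simp
    ultimately have head: "integral {0..a} ?g \<ge> ?k0 * (A / 2 - 1) - 4 * ?k0"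
      using ka by linarith
    have "0 \<le> ?k0 * (A / 2 - 5 - 2 / (1 - \<alpha>))"
      using A by (intro mult_nonneg_nonneg) auto
    also have "\<dots> = (?k0 * (A / 2 - 1) - 4 * ?k0) + - (2 * ?k0 / (1 - \<alpha>))"
      by (simp add: algebra_simps)
    also have "\<dots> \<le> integral {0..a} ?g + integral {a..t} ?g"
      by (intro add_mono head tail)
    also have "\<dots> = integral {0..t} ?g"
      using a by (intro Henstock_Kurzweil_Integration.integral_combine int) auto
    finally show ?thesis .
  qed
qed

section \<open>Oscillation at infinity and boundedness\<close>

lemma frequently_sin_ln_eq: "\<exists>\<^sub>F t in at_top. t \<ge> 0 \<and> sin (ln (1 + t)) = sin x"
  for x :: real
proof -
  have "\<exists>t\<ge>N. t \<ge> 0 \<and> sin (ln (1 + t)) = sin x" for N :: real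
  proof -
    obtain n :: nat where n: "real n > max (\<bar>N\<bar> + \<bar>x\<bar>) 1"
      using reals_Archimedean2 by blast
    \<comment> \<open>The witness is \<open>exp y - 1\<close>, at which the logarithm is exactly
      \<open>y\<close>; it is at least \<open>y\<close>, hence at least \<open>N\<close>.\<close>
    define y where "y = x + 2 * pi * real n"
    have "1 * real n \<le> 2 * pi * real n"
      using pi_gt3 by (intro mult_right_mono) (linarith | simp)+
    then have y: "y \<ge> \<bar>N\<bar>"
      using n unfolding y_def by linarith
    have "exp y \<ge> 1 + y"
      by simp
    then have "exp y - 1 \<ge> N" "exp y - 1 \<ge> 0"
      using y by linarith+
    moreover have "sin (ln (1 + (exp y - 1))) = sin x"
      using sin.plus_of_nat [of x n] by (simp add: y_def mult_ac)
    ultimately show ?thesis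
      by blast
  qed
  then show ?thesis
    unfolding frequently_def eventually_at_top_linorder by blast
qed

lemma Liminf_le_of_frequently:
  fixes f :: "'a \<Rightarrow> 'b :: complete_linorder"
  assumes "\<exists>\<^sub>F x in F. f x \<le> c"
  shows "Liminf F f \<le> c"
  using assms less_LiminfD [of c F f] by (force simp: frequently_def not_le)

lemma Limsup_ge_of_frequently:
  fixes f :: "'a \<Rightarrow> 'b :: complete_linorder"
  assumes "\<exists>\<^sub>F x in F. f x \<ge> c"
  shows "Limsup F f \<ge> c"
  using assms Limsup_lessD [of F f c] by (force simp: frequently_def not_le)

text \<open>Where the sine is -1 the value is at most \<open>A - 1\<close>. Where it is 1 the values
  approach \<open>A + 1\<close> from below, so the lower level \<open>A\<close> is eventually
  reached and still leaves a gap.\<close>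

lemma log_osc_Liminf_less_Limsup:
  assumes "A \<ge> 0"
  shows "Liminf at_top (\<lambda>t. ereal (log_osc A t)) < Limsup at_top (\<lambda>t. ereal (log_osc A t))"
proof -
  have "\<exists>\<^sub>F t in at_top. ereal (log_osc A t) \<le> ereal (A - 1)"
  proof (rule frequently_mono [OF _ frequently_sin_ln_eq [of "- (pi / 2)"]], intro allI impI)
    fix t :: real
    assume t: "t \<ge> 0 \<and> sin (ln (1 + t)) = sin (- (pi / 2))"
    then have "A * (t / (1 + t)) \<le> A * 1"
      using assms by (intro mult_left_mono) auto
    with t show "ereal (log_osc A t) \<le> ereal (A - 1)"
      by (simp add: log_osc_def)
  qed
  then have inf: "Liminf at_top (\<lambda>t. ereal (log_osc A t)) \<le> ereal (A - 1)"
    by (rule Liminf_le_of_frequently)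
  have "\<exists>\<^sub>F t in at_top. ereal (log_osc A t) \<ge> ereal A"
  proof (rule frequently_rev_mp [OF frequently_sin_ln_eq [of "pi / 2"]])
    show "\<forall>\<^sub>F t in at_top. t \<ge> 0 \<and> sin (ln (1 + t)) = sin (pi / 2) \<longrightarrow> ereal (log_osc A t) \<ge> ereal A"
      using eventually_ge_at_top [of A]
    proof eventually_elim
      case (elim t)
      \<comment> \<open>The deficit \<open>A / (1 + t)\<close> of the rational part is below 1 once
        \<open>t\<close> is at least \<open>A\<close>.\<close>
      have "A * (t / (1 + t)) + 1 \<ge> A" if "t \<ge> 0"
        using that elim by (simp add: field_simps)
      then show ?case
        by (auto simp: log_osc_def)
    qed
  qed
  then have "ereal A \<le> Limsup at_top (\<lambda>t. ereal (log_osc A t))"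
    by (rule Limsup_ge_of_frequently)
  moreover have "ereal (A - 1) < ereal A"
    by simp
  ultimately show ?thesis
    using inf by (meson le_less_trans less_le_trans)
qed

lemma bounded_log_osc: "bounded (log_osc A ` {0..})"
proof (rule boundedI)
  fix y
  assume "y \<in> log_osc A ` {0..}"
  then obtain t where t: "t \<ge> 0" "y = log_osc A t"
    by auto
  have "\<bar>A * (t / (1 + t))\<bar> \<le> \<bar>A\<bar> * 1"
    unfolding abs_mult using t by (intro mult_left_mono) auto
  then show "norm y \<le> \<bar>A\<bar> + 1"
    using abs_sin_le_one [of "ln (1 + t)"] unfolding t log_osc_def real_norm_def by linarith
qed

theorem mainTheorem3:
  fixes \<alpha> :: real
  assumes "0 < \<alpha>" and "\<alpha> < 1"
  shows "\<exists>u :: real \<Rightarrow> real.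
    bounded (u ` {0..}) \<and>
    (\<forall>t>0. caputo_deriv_exists \<alpha> u t) \<and>
    (\<forall>t>0. caputo_deriv \<alpha> u t \<ge> 0) \<and>
    Liminf at_top (\<lambda>t. ereal (u t)) < Limsup at_top (\<lambda>t. ereal (u t)) \<and>
    \<not> (\<exists>L. (u \<longlongrightarrow> L) at_top)"
proof -
  define A where "A = 10 + 4 / (1 - \<alpha>)"
  have A: "A \<ge> 0"
    using assms by (simp add: A_def)
  have cont: "continuous_on {0..t} (log_osc' A)" for t
    by (rule continuous_on_subset [OF continuous_on_log_osc']) auto
  have der: "(log_osc A has_real_derivative log_osc' A s) (at s)" if "s > 0" for s
    using that by (intro log_osc_has_derivative) auto
  have C1: "log_osc A C1_differentiable_on {0<..}"
    unfolding C1_differentiable_on_def has_real_derivative_iff_has_vector_derivative [symmetric]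
  proof (intro exI conjI ballI)
    show "continuous_on {0<..} (log_osc' A)"
      by (rule continuous_on_subset [OF continuous_on_log_osc']) auto
  qed (simp add: der)
  have "caputo_deriv_exists \<alpha> (log_osc A) t" if "t > 0" for t
    unfolding caputo_deriv_exists_def
    using C1 caputo_integrand_set_integrable [OF assms(2) _ cont der] that by auto
  moreover have "caputo_deriv \<alpha> (log_osc A) t \<ge> 0" if "t > 0" for t
  proof -
    have "caputo_deriv \<alpha> (log_osc A) t
        = 1 / Gamma (1 - \<alpha>) * integral {0..t} (\<lambda>s. log_osc' A s * (t - s) powr (-\<alpha>))"
      using caputo_deriv_eq_integral [OF assms(2) _ cont der] that by auto
    moreover have "Gamma (1 - \<alpha>) > 0"
      using assms by (intro Gamma_real_pos) auto
    ultimately show ?thesis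
      using integral_log_osc'_kernel_nonneg [OF assms that, of A] by (simp add: A_def)
  qed
  moreover note less = log_osc_Liminf_less_Limsup [OF A]
  moreover have "\<not> (\<exists>L. (log_osc A \<longlongrightarrow> L) at_top)"
  proof
    assume "\<exists>L. (log_osc A \<longlongrightarrow> L) at_top"
    then obtain L where "((\<lambda>t. ereal (log_osc A t)) \<longlongrightarrow> ereal L) at_top"
      by auto
    then show False
      using less lim_imp_Liminf lim_imp_Limsup by (metis less_irrefl trivial_limit_at_top_linorder)
  qed
  ultimately show ?thesis
    using bounded_log_osc by blast
qed

end
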